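(* Let $(M,d)$ be a metric space, let $\Theta\subseteq M$ be permeable relative to $M$, and let $(Y,d_Y)$ be a metric space. Then every continuous function $f\colon M\to Y$ which is intrinsically $L$-Lipschitz continuous on $E=M\setminus\Theta$ is intrinsically $L$-Lipschitz continuous on the whole of $M$.
   Context: Let $(M,d)$ be a metric space. A path in $M$ is a continuous map $\gamma\colon[a,b]\to M$; it is a path from $\gamma(a)$ to $\gamma(b)$. Its length is $\ell(\gamma):=\sup\{\sum_{k=1}^n d(\gamma(t_k),\gamma(t_{k-1})) : n\in\mathbb{N},\ a=t_0<\dots<t_n=b\}$. For $E\subseteq M$ and $x,y\in E$, the intrinsic metric is $\rho_E(x,y):=\inf\{\ell(\gamma)\}$, the infimum over all paths $\gamma$ of finite length with image in $E$ from $x$ to $y$ (lengths and continuity with respect to $d$), with $\inf\emptyset=\infty$ (so $\rho_E$ may take the value $\infty$). A function $f\colon M\to Y$ into a metric space $(Y,d_Y)$ is intrinsically $L$-Lipschitz continuous on $E\subseteq M$ if $d_Y(f(x),f(y))\le L\,\rho_E(x,y)$ for all $x,y\in E$ (no condition is imposed when $\rho_E(x,y)=\infty$). For $\Theta\subseteq M$ and $x,y\in M$, let $\rho_M^\Theta(x,y)$ be the infimum of $\ell(\gamma)$ over all paths $\gamma\colon[a,b]\to M$ of finite length from $x$ to $y$ such that the closure $\overline{\gamma([a,b])\cap\Theta}$ is at most countable ($\inf\emptyset=\infty$). The set $\Theta$ is permeable relative to $M$ if $\rho_M=\rho_M^\Theta$. *)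

theory Defs
  imports "HOL-Analysis.Analysis"
begin

text \<open>
  The ambient metric space \<open>M\<close> is a type of class \<open>metric_space\<close>, so that \<open>M\<close> itself is \<open>UNIV\<close>.
  Paths are functions on \<open>real\<close> considered on an arbitrary interval \<open>{a..b}\<close>; their values outside
  of it play no role.  The degenerate case \<open>a = b\<close> is allowed, and is the only one
  in which a partition with \<open>n = 0\<close> exists.
\<close>

definition path_from_to :: "real \<Rightarrow> real \<Rightarrow> (real \<Rightarrow> 'a::metric_space) \<Rightarrow> 'a \<Rightarrow> 'a \<Rightarrow> bool" where
  "path_from_to a b \<gamma> x y \<longleftrightarrow>
     a \<le> b \<and> continuous_on {a..b} \<gamma> \<and> \<gamma> a = x \<and> \<gamma> b = y"

definition partition_points :: "real \<Rightarrow> real \<Rightarrow> nat \<Rightarrow> (nat \<Rightarrow> real) \<Rightarrow> bool" where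
  "partition_points a b n t \<longleftrightarrow> t 0 = a \<and> t n = b \<and> (\<forall>k<n. t k < t (Suc k))"

definition curve_length :: "real \<Rightarrow> real \<Rightarrow> (real \<Rightarrow> 'a::metric_space) \<Rightarrow> ennreal" where
  "curve_length a b \<gamma> =
     Sup {ennreal (\<Sum>k=1..n. dist (\<gamma> (t k)) (\<gamma> (t (k - 1)))) | n t. partition_points a b n t}"

text \<open>In \<open>ennreal\<close> the infimum of the empty set is \<open>\<infinity>\<close>.\<close>

definition intrinsic_metric :: "'a::metric_space set \<Rightarrow> 'a \<Rightarrow> 'a \<Rightarrow> ennreal" where
  "intrinsic_metric E x y =
     Inf {curve_length a b \<gamma> | a b \<gamma>.
       path_from_to a b \<gamma> x y \<and> \<gamma> ` {a..b} \<subseteq> E \<and> curve_length a b \<gamma> < \<infinity>}"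

definition intrinsic_metric_across :: "'a::metric_space set \<Rightarrow> 'a \<Rightarrow> 'a \<Rightarrow> ennreal" where
  "intrinsic_metric_across \<Theta> x y =
     Inf {curve_length a b \<gamma> | a b \<gamma>.
       path_from_to a b \<gamma> x y \<and> countable (closure (\<gamma> ` {a..b} \<inter> \<Theta>)) \<and> curve_length a b \<gamma> < \<infinity>}"

definition permeable :: "'a::metric_space set \<Rightarrow> bool" where
  "permeable \<Theta> \<longleftrightarrow> (\<forall>x y. intrinsic_metric UNIV x y = intrinsic_metric_across \<Theta> x y)"

text \<open>
  Points at infinite intrinsic distance are excluded explicitly, both because \<open>enn2real \<infinity> = 0\<close>
  and so that no convention for \<open>0 \<cdot> \<infinity>\<close> is involved when \<open>L = 0\<close>.
\<close>

definition intrinsically_lipschitz_on ::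
    "real \<Rightarrow> 'a::metric_space set \<Rightarrow> ('a \<Rightarrow> 'b::metric_space) \<Rightarrow> bool" where
  "intrinsically_lipschitz_on L E f \<longleftrightarrow>
     (\<forall>x\<in>E. \<forall>y\<in>E. intrinsic_metric E x y < \<infinity> \<longrightarrow>
        dist (f x) (f y) \<le> L * enn2real (intrinsic_metric E x y))"

end

theory Submission imports Defs begin

text \<open>
  Let \<open>\<gamma>\<close> be a rectifiable path from \<open>x\<close> to \<open>y\<close> whose intersection with \<open>\<Theta>\<close> has countable closure
  \<open>C\<close>, and put \<open>h t = d(f x, f (\<gamma> t))\<close>.  Although \<open>\<gamma>\<inverse>(C)\<close> may be uncountable, its image under \<open>h\<close> is
  countable, hence contained in an open set \<open>G\<close> of arbitrarily small Lebesgue measure.  The bound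
  \<open>\<lambda>(h[s,t] - G) \<le> L \<cdot> \<ell>(\<gamma> on [s,t])\<close> is stable under concatenation of intervals and holds on all small
  intervals: around a parameter in \<open>\<gamma>\<inverse>(C)\<close> the left-hand side vanishes, and around any other one
  \<open>\<gamma>\<close> runs in the complement of \<open>\<Theta>\<close>.  So it holds on the whole interval, where the image of \<open>h\<close>
  contains \<open>[0, d(f x, f y)]\<close>.
\<close>

section \<open>Length of curves: concatenation and monotonicity\<close>

lemma sum_le_curve_length:
  assumes "partition_points a b n t"
  shows "ennreal (\<Sum>k=1..n. dist (\<gamma> (t k)) (\<gamma> (t (k - 1)))) \<le> curve_length a b \<gamma>"
  unfolding curve_length_def using assms by (intro Sup_upper) blast

lemma dist_le_curve_length:
  assumes "a \<le> b"
  shows "ennreal (dist (\<gamma> a) (\<gamma> b)) \<le> curve_length a b \<gamma>"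
proof (cases "a = b")
  case False
  then have "partition_points a b 1 (\<lambda>k. if k = 0 then a else b)"
    using assms by (auto simp: partition_points_def)
  from sum_le_curve_length[OF this, of \<gamma>] show ?thesis
    by (simp add: dist_commute)
qed simp

lemma partition_points_append:
  assumes "partition_points a b n t" "partition_points b c m u"
  shows "partition_points a c (n + m) (\<lambda>k. if k \<le> n then t k else u (k - n))"
  unfolding partition_points_def
proof (intro conjI allI impI)
  fix k assume k: "k < n + m"
  consider "k < n" | "k = n" "m > 0" | "k > n" using k by linarith
  then show "(if k \<le> n then t k else u (k - n)) < (if Suc k \<le> n then t (Suc k) else u (Suc k - n))"
  proof cases
    case 2
    then show ?thesis using assms by (auto simp: partition_points_def)
  next
    case 3
    then have "u (k - n) < u (Suc (k - n))"
      using assms k by (auto simp: partition_points_def)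
    then show ?thesis using 3 by (simp add: Suc_diff_le)
  qed (use assms in \<open>auto simp: partition_points_def\<close>)
qed (use assms in \<open>auto simp: partition_points_def\<close>)

lemma partition_points_exists:
  assumes "a \<le> b"
  shows "\<exists>n t. partition_points a b n t"
proof (cases "a = b")
  case True
  then have "partition_points a b 0 (\<lambda>_. a)" by (simp add: partition_points_def)
  then show ?thesis by blast
next
  case False
  then have "partition_points a b 1 (\<lambda>k. if k = 0 then a else b)"
    using assms by (auto simp: partition_points_def)
  then show ?thesis by blast
qed

text \<open>Partitions of the two halves concatenate at \<open>b\<close> to a partition of the
  whole, so every pair of approximating sums adds up to one for \<open>a\<close>, \<open>c\<close>.
  This is what carries the local estimate over to unions of adjacent intervals.\<close>

lemma curve_length_superadditive:
  assumes "a \<le> b" "b \<le> c"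
  shows "curve_length a b \<gamma> + curve_length b c \<gamma> \<le> curve_length a c \<gamma>"
proof -
  let ?S = "\<lambda>n t. \<Sum>k=1..n. dist (\<gamma> (t k)) (\<gamma> (t (k - 1)))"
  let ?P = "\<lambda>a b. {ennreal (?S n t) | n t. partition_points a b n t}"
  \<comment> \<open>Adding a constant commutes with a supremum in \<open>ennreal\<close> only over a
    nonempty index set.\<close>
  have ne: "?P a b \<noteq> {}" "?P b c \<noteq> {}"
    using partition_points_exists assms by blast+
  have *: "ennreal (?S n t) + ennreal (?S m u) \<le> curve_length a c \<gamma>"
    if "partition_points a b n t" "partition_points b c m u" for n t m u
  proof -
    let ?w = "\<lambda>k. if k \<le> n then t k else u (k - n)"
    have nb: "t n = u 0" using that by (simp add: partition_points_def)
    have "?S (n + m) ?w = ?S n ?w + (\<Sum>k=n+1..n+m. dist (\<gamma> (?w k)) (\<gamma> (?w (k - 1))))"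
      by (rule sum.ub_add_nat) simp
    also have "?S n ?w = ?S n t" by (rule sum.cong) auto
    also have "(\<Sum>k=n+1..n+m. dist (\<gamma> (?w k)) (\<gamma> (?w (k - 1)))) =
        (\<Sum>k=1..m. dist (\<gamma> (?w (k + n))) (\<gamma> (?w (k + n - 1))))"
      using sum.shift_bounds_cl_nat_ivl[of "\<lambda>k. dist (\<gamma> (?w k)) (\<gamma> (?w (k - 1)))" 1 n m]
      by (simp add: add.commute)
    also have "\<dots> = ?S m u"
    proof (rule sum.cong)
      \<comment> \<open>The seam is \<open>k = 1\<close>: there \<open>k + n - 1 = n\<close> still
        selects \<open>t n\<close>, which equals \<open>u 0\<close>.\<close>
      fix k assume "k \<in> {1..m}"
      then show "dist (\<gamma> (?w (k + n))) (\<gamma> (?w (k + n - 1))) = dist (\<gamma> (u k)) (\<gamma> (u (k - 1)))"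
        using nb by (cases "k = 1") auto
    qed simp
    finally have "ennreal (?S n t) + ennreal (?S m u) = ennreal (?S (n + m) ?w)"
      by (simp add: ennreal_plus[symmetric] sum_nonneg del: ennreal_plus)
    also have "\<dots> \<le> curve_length a c \<gamma>"
      by (rule sum_le_curve_length[OF partition_points_append[OF that]])
    finally show ?thesis .
  qed
  have "curve_length a b \<gamma> + curve_length b c \<gamma> = (SUP p\<in>?P a b. SUP q\<in>?P b c. p + q)"
    unfolding curve_length_def
    using ennreal_SUP_add_left[OF ne(1), of "\<lambda>p. p" "Sup (?P b c)"]
      ennreal_SUP_add_right[OF ne(2), of _ "\<lambda>q. q"]
    by simp
  also have "\<dots> \<le> curve_length a c \<gamma>"
    using * by (intro SUP_least) auto
  finally show ?thesis .
qed

lemma curve_length_mono: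
  assumes "a \<le> s" "s \<le> t" "t \<le> b"
  shows "curve_length s t \<gamma> \<le> curve_length a b \<gamma>"
proof -
  have "curve_length s t \<gamma> \<le> curve_length a s \<gamma> + curve_length s t \<gamma>" by simp
  also have "\<dots> \<le> curve_length a t \<gamma>"
    using assms by (intro curve_length_superadditive)
  also have "\<dots> \<le> curve_length a t \<gamma> + curve_length t b \<gamma>" by simp
  also have "\<dots> \<le> curve_length a b \<gamma>"
    using assms by (intro curve_length_superadditive) auto
  finally show ?thesis .
qed

section \<open>Intrinsic metric and its use along a single curve\<close>

lemma intrinsic_metric_le_curve_length:
  assumes "path_from_to a b \<gamma> x y" "\<gamma> ` {a..b} \<subseteq> E" "curve_length a b \<gamma> < \<infinity>"
  shows "intrinsic_metric E x y \<le> curve_length a b \<gamma>"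
  unfolding intrinsic_metric_def using assms by (intro Inf_lower) blast

text \<open>A chord is never longer than the curve. Hence intrinsic distance 0 forces equality of
  points, which settles negative Lipschitz constants.\<close>

lemma dist_le_intrinsic_metric: "ennreal (dist x y) \<le> intrinsic_metric E x y"
  unfolding intrinsic_metric_def
  by (intro Inf_greatest) (auto simp: path_from_to_def dist_le_curve_length)

lemma intrinsic_metric_refl:
  assumes "x \<in> E"
  shows "intrinsic_metric E x x = 0"
proof -
  have "curve_length 0 0 (\<lambda>_. x) = 0"
    by (auto simp: curve_length_def intro!: antisym Sup_least)
  then show ?thesis
    using intrinsic_metric_le_curve_length[of 0 0 "\<lambda>_. x" x x E] assms
    by (auto simp: path_from_to_def)
qed

text \<open>Continuity phrased for short intervals around \<open>x\<close>, the shape of the local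
  hypothesis in \<open>Bolzano\<close>.\<close>

lemma continuous_on_interval_nhd:
  fixes g :: "real \<Rightarrow> 'a::metric_space"
  assumes "continuous_on {a..b} g" "x \<in> {a..b}" "open S" "g x \<in> S"
  obtains d where "d > 0" "\<And>s t. a \<le> s \<Longrightarrow> s \<le> x \<Longrightarrow> x \<le> t \<Longrightarrow> t \<le> b \<Longrightarrow> t - s < d \<Longrightarrow> g ` {s..t} \<subseteq> S"
proof -
  obtain e where e: "e > 0" "ball (g x) e \<subseteq> S"
    using assms(3,4) open_contains_ball by blast
  obtain d where d: "d > 0" "\<And>u. u \<in> {a..b} \<Longrightarrow> dist u x < d \<Longrightarrow> dist (g u) (g x) < e"
    using assms(1,2) e(1) unfolding continuous_on_iff by blast
  show thesis
  proof (rule that[OF d(1)], rule image_subsetI)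
    fix s t u assume "a \<le> s" "s \<le> x" "x \<le> t" "t \<le> b" "t - s < d" "u \<in> {s..t}"
    then have "dist (g u) (g x) < e" by (intro d(2)) (auto simp: dist_real_def)
    then show "g u \<in> S" using e(2) by (auto simp: dist_commute)
  qed
qed

text \<open>The curve itself competes in the infimum, and its finite length makes the intrinsic
  distance finite, so that the Lipschitz condition says something.\<close>

lemma intrinsically_lipschitz_on_curve:
  assumes lip: "intrinsically_lipschitz_on L E f" and "0 \<le> L" "s \<le> t"
    and "continuous_on {s..t} \<gamma>" "\<gamma> ` {s..t} \<subseteq> E" "curve_length s t \<gamma> < \<infinity>"
  shows "ennreal (dist (f (\<gamma> s)) (f (\<gamma> t))) \<le> ennreal L * curve_length s t \<gamma>"
proof -
  have le: "intrinsic_metric E (\<gamma> s) (\<gamma> t) \<le> curve_length s t \<gamma>"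
    using assms by (intro intrinsic_metric_le_curve_length) (auto simp: path_from_to_def)
  then have fin: "intrinsic_metric E (\<gamma> s) (\<gamma> t) < \<infinity>"
    using assms(6) by (rule le_less_trans)
  have "dist (f (\<gamma> s)) (f (\<gamma> t)) \<le> L * enn2real (intrinsic_metric E (\<gamma> s) (\<gamma> t))"
    using lip fin assms(3,5) unfolding intrinsically_lipschitz_on_def by force
  then have "ennreal (dist (f (\<gamma> s)) (f (\<gamma> t))) \<le> ennreal (L * enn2real (intrinsic_metric E (\<gamma> s) (\<gamma> t)))"
    by (rule ennreal_leI)
  also have "\<dots> = ennreal L * intrinsic_metric E (\<gamma> s) (\<gamma> t)"
    using fin \<open>0 \<le> L\<close> by (simp add: ennreal_mult)
  also have "\<dots> \<le> ennreal L * curve_length s t \<gamma>"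
    using le by (intro mult_left_mono) auto
  finally show ?thesis .
qed

section \<open>The measure estimate along a path with countable closed crossing set\<close>

lemma dist_le_curve_length_across:
  fixes \<Theta> :: "'a::metric_space set" and f :: "'a \<Rightarrow> 'b::metric_space"
  assumes cf: "continuous_on UNIV f"
    and lip: "intrinsically_lipschitz_on L (UNIV - \<Theta>) f" and L: "0 \<le> L"
    and \<gamma>: "path_from_to a b \<gamma> x y"
    and C: "countable (closure (\<gamma> ` {a..b} \<inter> \<Theta>))"
    and fin: "curve_length a b \<gamma> < \<infinity>"
  shows "ennreal (dist (f x) (f y)) \<le> ennreal L * curve_length a b \<gamma>"
proof (rule ennreal_le_epsilon)
  fix e :: real assume "0 < e"
  define C where "C = closure (\<gamma> ` {a..b} \<inter> \<Theta>)"
  define h where "h t = dist (f x) (f (\<gamma> t))" for t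
  have ab: "a \<le> b" and c\<gamma>: "continuous_on {a..b} \<gamma>" and ends: "\<gamma> a = x" "\<gamma> b = y"
    using \<gamma> by (auto simp: path_from_to_def)
  have ch: "continuous_on {a..b} h"
    unfolding h_def
    by (intro continuous_intros continuous_on_compose2[OF cf c\<gamma>]) auto
  let ?N = "(\<lambda>z. dist (f x) (f z)) ` C"
  have N: "countable ?N" using C by (simp add: C_def)
  then have "?N \<in> sets borel" by (simp add: sets.countable)
  then obtain G where G: "open G" "?N \<subseteq> G" "emeasure lborel (G - ?N) < ennreal e"
    using outer_regular_lborel[OF _ \<open>0 < e\<close>] by metis
  have mG: "G \<in> sets borel" using G(1) by simp
  have "emeasure lborel G \<le> emeasure lborel (G - ?N) + emeasure lborel ?N"
    using emeasure_subadditive[of "G - ?N" lborel ?N] mG \<open>?N \<in> sets borel\<close> G(2)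
    by (simp add: Un_absorb2)
  then have eG: "emeasure lborel G \<le> ennreal e"
    using G(3) emeasure_lborel_countable[OF N] by simp
  \<comment> \<open>Compactness of these images gives the measurability that subadditivity of
    \<open>lborel\<close> asks for.\<close>
  have meas: "h ` {s..t} \<in> sets borel" if "a \<le> s" "t \<le> b" for s t
  proof -
    have "compact (h ` {s..t})"
      using that by (intro compact_continuous_image continuous_on_subset[OF ch]) auto
    then show ?thesis by (rule borel_compact)
  qed
  \<comment> \<open>\<open>Bolzano\<close> also tests intervals that stick out of
    \<open>{a..b}\<close>; the two premises make \<open>Q\<close> vacuous for them.\<close>
  define Q where "Q s t \<longleftrightarrow> (a \<le> s \<longrightarrow> t \<le> b \<longrightarrow>
    emeasure lborel (h ` {s..t} - G) \<le> ennreal L * curve_length s t \<gamma>)" for s t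
  have "Q a b"
  proof (rule Bolzano[OF ab])
    fix s u t assume Q: "Q s u" "Q u t" and le: "s \<le> u" "u \<le> t"
    show "Q s t"
      unfolding Q_def
    proof (intro impI)
      assume st: "a \<le> s" "t \<le> b"
      have "h ` {s..t} - G = (h ` {s..u} - G) \<union> (h ` {u..t} - G)"
        using ivl_disj_un_two_touch(4)[OF le] by blast
      then have "emeasure lborel (h ` {s..t} - G) \<le>
          emeasure lborel (h ` {s..u} - G) + emeasure lborel (h ` {u..t} - G)"
        using st le mG meas by (auto intro!: emeasure_subadditive)
      also have "\<dots> \<le> ennreal L * curve_length s u \<gamma> + ennreal L * curve_length u t \<gamma>"
        using Q st le unfolding Q_def by (intro add_mono) auto
      also have "\<dots> = ennreal L * (curve_length s u \<gamma> + curve_length u t \<gamma>)"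
        by (simp add: distrib_left)
      also have "\<dots> \<le> ennreal L * curve_length s t \<gamma>"
        using curve_length_superadditive[OF le] by (intro mult_left_mono) auto
      finally show "emeasure lborel (h ` {s..t} - G) \<le> ennreal L * curve_length s t \<gamma>" .
    qed
  next
    fix p assume p: "a \<le> p" "p \<le> b"
    show "\<exists>d>0. \<forall>s t. s \<le> p \<and> p \<le> t \<and> t - s < d \<longrightarrow> Q s t"
    proof (cases "\<gamma> p \<in> C")
      case True
      then have "h p \<in> G" using G(2) by (auto simp: h_def)
      then obtain d where d: "d > 0"
        "\<And>s t. a \<le> s \<Longrightarrow> s \<le> p \<Longrightarrow> p \<le> t \<Longrightarrow> t \<le> b \<Longrightarrow> t - s < d \<Longrightarrow> h ` {s..t} \<subseteq> G"
        using continuous_on_interval_nhd[OF ch _ G(1)] p by (metis atLeastAtMost_iff)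
      have "Q s t" if st: "s \<le> p" "p \<le> t" "t - s < d" for s t
        unfolding Q_def
      proof (intro impI)
        assume "a \<le> s" "t \<le> b"
        then have "h ` {s..t} - G = {}" using d(2) st by blast
        then show "emeasure lborel (h ` {s..t} - G) \<le> ennreal L * curve_length s t \<gamma>"
          by (simp only: emeasure_empty zero_le)
      qed
      then show ?thesis using d(1) by blast
    next
      case False
      \<comment> \<open>This is where the closure matters: a whole parameter interval around
        \<open>p\<close> avoids \<open>C\<close>, hence \<Theta>.\<close>
      have "open (- C)" by (simp add: C_def open_Compl)
      then obtain d where d: "d > 0"
        "\<And>s t. a \<le> s \<Longrightarrow> s \<le> p \<Longrightarrow> p \<le> t \<Longrightarrow> t \<le> b \<Longrightarrow> t - s < d \<Longrightarrow> \<gamma> ` {s..t} \<subseteq> - C"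
        using continuous_on_interval_nhd[OF c\<gamma>] p False by (metis ComplI atLeastAtMost_iff)
      have "Q s t" if st: "s \<le> p" "p \<le> t" "t - s < d" for s t
        unfolding Q_def
      proof (intro impI)
        assume "a \<le> s" "t \<le> b"
        then have ast: "a \<le> s" "s \<le> t" "t \<le> b" using st by auto
        have E: "\<gamma> ` {s..t} \<subseteq> UNIV - \<Theta>"
        proof (intro image_subsetI DiffI UNIV_I notI)
          fix u assume u: "u \<in> {s..t}" "\<gamma> u \<in> \<Theta>"
          then have "\<gamma> u \<in> C"
            unfolding C_def using ast by (intro subsetD[OF closure_subset]) auto
          then show False using d(2)[OF ast(1) st(1,2) ast(3) st(3)] u by blast
        qed
        \<comment> \<open>Minimum and maximum of \<open>h\<close> may be attained in either order,
          so \<open>u\<close> and \<open>v\<close> are not assumed ordered; \<open>min\<close> and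
          \<open>max\<close> restore the order for the curve between them. A negative difference is
          harmless, since \<open>ennreal\<close> maps it to 0.\<close>
        have bd: "ennreal (h v - h u) \<le> ennreal L * curve_length s t \<gamma>"
          if uv: "u \<in> {s..t}" "v \<in> {s..t}" for u v
        proof -
          let ?l = "min u v" and ?r = "max u v"
          have lr: "s \<le> ?l" "?l \<le> ?r" "?r \<le> t" using uv by auto
          have cl: "curve_length ?l ?r \<gamma> \<le> curve_length s t \<gamma>"
            by (rule curve_length_mono[OF lr])
          have "curve_length s t \<gamma> \<le> curve_length a b \<gamma>"
            by (rule curve_length_mono[OF ast])
          then have fin': "curve_length ?l ?r \<gamma> < \<infinity>"
            using cl fin by (meson le_less_trans)
          have "h v - h u \<le> dist (f (\<gamma> u)) (f (\<gamma> v))"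
            using dist_triangle[of "f x" "f (\<gamma> v)" "f (\<gamma> u)"] by (simp add: h_def)
          also have "\<dots> = dist (f (\<gamma> ?l)) (f (\<gamma> ?r))"
            by (auto simp: min_def max_def dist_commute)
          finally have "ennreal (h v - h u) \<le> ennreal (dist (f (\<gamma> ?l)) (f (\<gamma> ?r)))"
            by (rule ennreal_leI)
          also have "\<dots> \<le> ennreal L * curve_length ?l ?r \<gamma>"
          proof (rule intrinsically_lipschitz_on_curve[OF lip L lr(2) _ _ fin'])
            have sub: "{?l..?r} \<subseteq> {s..t}" using lr by auto
            show "continuous_on {?l..?r} \<gamma>"
              using sub ast by (intro continuous_on_subset[OF c\<gamma>]) auto
            show "\<gamma> ` {?l..?r} \<subseteq> UNIV - \<Theta>" using sub E by blast
          qed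
          also have "\<dots> \<le> ennreal L * curve_length s t \<gamma>"
            using cl by (intro mult_left_mono) auto
          finally show ?thesis .
        qed
        have "continuous_on {s..t} h"
          using ast by (intro continuous_on_subset[OF ch]) auto
        \<comment> \<open>The image is a compact interval, so its measure is the oscillation of
          \<open>h\<close>, realised by two parameters to which \<open>bd\<close> applies.\<close>
        then obtain l r where lr: "h ` {s..t} = {l..r}" "l \<le> r"
          using continuous_image_closed_interval[OF ast(2)] by blast
        have "l \<in> h ` {s..t}" "r \<in> h ` {s..t}" using lr by auto
        then obtain u v where uv: "u \<in> {s..t}" "v \<in> {s..t}" "l = h u" "r = h v"
          by blast
        have "emeasure lborel (h ` {s..t} - G) \<le> emeasure lborel {l..r}"
          using lr(1) by (intro emeasure_mono) auto
        also have "\<dots> = ennreal (h v - h u)" using lr(2) uv(3,4) by simp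
        also have "\<dots> \<le> ennreal L * curve_length s t \<gamma>" by (rule bd[OF uv(1,2)])
        finally show "emeasure lborel (h ` {s..t} - G) \<le> ennreal L * curve_length s t \<gamma>" .
      qed
      then show ?thesis using d(1) by blast
    qed
  qed
  then have Qab: "emeasure lborel (h ` {a..b} - G) \<le> ennreal L * curve_length a b \<gamma>"
    by (simp add: Q_def)
  \<comment> \<open>Since \<gamma> starts at \<open>x\<close>, \<open>h a = 0\<close> and
    \<open>h b\<close> is the distance to be bounded; intermediate values fill the gap.\<close>
  have "{h a..h b} \<subseteq> h ` {a..b}"
  proof
    fix z assume "z \<in> {h a..h b}"
    then show "z \<in> h ` {a..b}" using IVT'[OF _ _ ab ch, of z] by auto
  qed
  have "ennreal (dist (f x) (f y)) = emeasure lborel {h a..h b}"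
    using ends by (simp add: h_def)
  also have "\<dots> \<le> emeasure lborel ((h ` {a..b} - G) \<union> G)"
    using \<open>{h a..h b} \<subseteq> h ` {a..b}\<close> meas[of a b] mG by (intro emeasure_mono) auto
  also have "\<dots> \<le> emeasure lborel (h ` {a..b} - G) + emeasure lborel G"
    using meas[of a b] mG by (intro emeasure_subadditive) auto
  also have "\<dots> \<le> ennreal L * curve_length a b \<gamma> + ennreal e"
    using Qab eG by (rule add_mono)
  finally show "ennreal (dist (f x) (f y)) \<le> ennreal L * curve_length a b \<gamma> + ennreal e" .
qed

section \<open>Passage to the infimum over paths, and the sign of \<open>L\<close>\<close>

lemma permeable_extends_intrinsically_lipschitz_nonneg:
  fixes \<Theta> :: "'a::metric_space set" and f :: "'a \<Rightarrow> 'b::metric_space"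
  assumes "permeable \<Theta>" "continuous_on UNIV f"
    and "intrinsically_lipschitz_on L (UNIV - \<Theta>) f" and L: "0 \<le> L"
  shows "intrinsically_lipschitz_on L UNIV f"
  unfolding intrinsically_lipschitz_on_def
proof (intro ballI impI)
  fix x y :: 'a
  let ?S = "{curve_length a b \<gamma> | a b \<gamma>. path_from_to a b \<gamma> x y \<and>
    countable (closure (\<gamma> ` {a..b} \<inter> \<Theta>)) \<and> curve_length a b \<gamma> < \<infinity>}"
  have S: "intrinsic_metric UNIV x y = Inf ?S"
    using assms(1) by (simp add: permeable_def intrinsic_metric_across_def)
  assume fin: "intrinsic_metric UNIV x y < \<infinity>"
  have bd: "ennreal (dist (f x) (f y)) \<le> ennreal L * l" if "l \<in> ?S" for l
    using that dist_le_curve_length_across[OF assms(2,3) L] by blast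
  have "?S \<noteq> {}" using fin S by (metis Inf_empty infinity_ennreal_def less_irrefl top_ennreal_def)
  show "dist (f x) (f y) \<le> L * enn2real (intrinsic_metric UNIV x y)"
  \<comment> \<open>For \<open>L = 0\<close> one admissible path already forces the distance to
    vanish; for \<open>L > 0\<close> dividing by \<open>L\<close> turns \<open>bd\<close> into a
    lower bound of \<open>?S\<close>, which passes to the infimum.\<close>
  proof (cases "L = 0")
    case True
    then show ?thesis using \<open>?S \<noteq> {}\<close> bd by fastforce
  next
    case False
    then have "0 < L" using L by simp
    have "ennreal (dist (f x) (f y) / L) \<le> Inf ?S"
    proof (rule Inf_greatest)
      fix l assume l: "l \<in> ?S"
      then obtain r where r: "l = ennreal r" "0 \<le> r"
        by (cases l) auto
      then have "dist (f x) (f y) \<le> L * r"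
        using bd[OF l] L by (simp add: ennreal_mult[symmetric])
      then show "ennreal (dist (f x) (f y) / L) \<le> l"
        using r \<open>0 < L\<close> by (simp add: field_simps)
    qed
    then have "dist (f x) (f y) / L \<le> enn2real (intrinsic_metric UNIV x y)"
      using enn2real_mono[of "ennreal (dist (f x) (f y) / L)" "intrinsic_metric UNIV x y"] fin S L
      by simp
    then show ?thesis using \<open>0 < L\<close> by (simp add: field_simps)
  qed
qed

theorem theorem15:
  fixes \<Theta> :: "'a::metric_space set"
    and f :: "'a \<Rightarrow> 'b::metric_space"
    and L :: real
  assumes "permeable \<Theta>"
    and "continuous_on UNIV f"
    and "intrinsically_lipschitz_on L (UNIV - \<Theta>) f"
  shows "intrinsically_lipschitz_on L UNIV f"
proof (cases "0 \<le> L")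
  \<comment> \<open>The measure estimate is stated with \<open>ennreal L\<close>, which is 0 for
    negative \<open>L\<close>; that sign is reduced to the constant 0 below.\<close>
  case True
  then show ?thesis using permeable_extends_intrinsically_lipschitz_nonneg assms by blast
next
  \<comment> \<open>For \<open>L < 0\<close> distinct points of the complement of \<open>\<Theta>\<close> have infinite distance, that is, the identity
     is intrinsically \<open>0\<close>-Lipschitz there; hence the same holds in the whole space.\<close>
  case False
  have eq: "x = y" if "x \<in> UNIV - \<Theta>" "y \<in> UNIV - \<Theta>" "intrinsic_metric (UNIV - \<Theta>) x y < \<infinity>" for x y
  proof -
    let ?r = "enn2real (intrinsic_metric (UNIV - \<Theta>) x y)"
    have "0 \<le> L * ?r"
      using that assms(3) zero_le_dist order_trans unfolding intrinsically_lipschitz_on_def by blast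
    then have "?r = 0"
      using False enn2real_nonneg[of "intrinsic_metric (UNIV - \<Theta>) x y"]
      by (auto simp: zero_le_mult_iff)
    then have "intrinsic_metric (UNIV - \<Theta>) x y = 0"
      using that(3) by (auto simp: enn2real_eq_0_iff)
    then show "x = y"
      using dist_le_intrinsic_metric[of x y "UNIV - \<Theta>"] by simp
  qed
  have "intrinsically_lipschitz_on 0 (UNIV - \<Theta>) (\<lambda>x. x)"
    using eq by (simp add: intrinsically_lipschitz_on_def)
  then have "intrinsically_lipschitz_on 0 UNIV (\<lambda>x::'a. x)"
    using permeable_extends_intrinsically_lipschitz_nonneg[OF assms(1) continuous_on_id] by simp
  \<comment> \<open>Finite distance now forces \<open>x = y\<close>, and then both sides are 0,
    whatever the sign of \<open>L\<close>.\<close>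
  then show ?thesis
    unfolding intrinsically_lipschitz_on_def by (fastforce simp: intrinsic_metric_refl)
qed

end
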